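(* Let $p$ be an odd prime, let $d$ be a positive integer, and let $q=p^d$. Let $S$ be an SLCE almost difference set over $\mathbb{F}_q$. Let $T$ be a set of distinct coset representatives of $\langle p\rangle$ in $(\mathbb{Z}/(q-1)\mathbb{Z})^*$, and let $t\in T$ be a multiplier of $S$. Then the sets $$S_0=\left\{ j\in T :\ d-\sum_{i=0}^{d-1}\left( \left\lfloor \frac{2(j^{-1})'p^i}{q-1}\right\rfloor-2\left\lfloor\frac{(j^{-1})'p^i}{q-1}\right\rfloor\right)>0\right\}$$ and $tS_0=\{tj : j\in S_0\}$ are either identical or disjoint.
   Context: SLCE almost difference set: let $q$ be a power of an odd prime and $\alpha$ a primitive element of $\mathbb{F}_q$. The Sidelnikov-Lempel-Cohn-Eastman (SLCE) sequence $\mathbf{s}=s_0s_1s_2\ldots$ defined using $\alpha$ is the binary sequence, periodic with $s_{j+q-1}=s_j$, given for $0\le j<q-1$ by $s_j=0$ if $\alpha^j+1$ is $0$ or a nonzero square in $\mathbb{F}_q$, and $s_j=1$ if $\alpha^j+1$ is a nonsquare in $\mathbb{F}_q$. The corresponding SLCE almost difference set is $S=\{j\in\mathbb{Z}/(q-1)\mathbb{Z} : s_j=1\}$ (equivalently, via $j\mapsto\alpha^j$, a subset of the cyclic group $\mathbb{F}_q^*$). Multipliers: a residue $t\in(\mathbb{Z}/(q-1)\mathbb{Z})^*$ is a multiplier of $S$ if there is $c\in\mathbb{Z}/(q-1)\mathbb{Z}$ with $\{tj : j\in S\}=\{j+c : j\in S\}$. For a residue class $r\in\mathbb{Z}/n\mathbb{Z}$,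 $r'$ denotes the least positive integer in the class $r$; $j^{-1}$ is the inverse of $j$ in $(\mathbb{Z}/(q-1)\mathbb{Z})^*$. $\langle p\rangle$ is the subgroup of $(\mathbb{Z}/(q-1)\mathbb{Z})^*$ generated by the class of $p$. Products $tj$ are taken in $(\mathbb{Z}/(q-1)\mathbb{Z})^*$. *)

theory Defs
  imports
    Complex_Main
    "HOL-Library.Cardinality"
    "HOL-Number_Theory.Residues"
    "HOL-Computational_Algebra.Nth_Powers"
    "HOL-Algebra.Coset"
    "HOL-Algebra.Generated_Groups"
begin

definition primitive_element :: "'a::{field,finite} \<Rightarrow> bool" where
  "primitive_element \<alpha> \<longleftrightarrow> range (\<lambda>k::nat. \<alpha> ^ k) = UNIV - {0}"

text \<open>The finite field is the whole type, so \<open>q\<close> is \<open>CARD('a)\<close>.  Reducing the index modulo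
  \<open>q - 1\<close> is the periodic continuation; \<open>is_nth_power 2\<close> holds of \<open>0\<close> as well as of the nonzero
  squares.\<close>

definition SLCE_seq :: "'a::{field,finite} \<Rightarrow> nat \<Rightarrow> nat" where
  "SLCE_seq \<alpha> j = (if is_nth_power 2 (\<alpha> ^ (j mod (CARD('a) - 1)) + 1) then 0 else 1)"

text \<open>The ring of integers modulo \<open>n\<close> has carrier \<open>{0..n - 1}\<close>, a set of integers.\<close>

abbreviation Zmod :: "nat \<Rightarrow> int ring" where
  "Zmod n \<equiv> residue_ring (int n)"

abbreviation Zmod_units :: "nat \<Rightarrow> int monoid" where
  "Zmod_units n \<equiv> units_of (Zmod n)"

definition SLCE_set :: "'a::{field,finite} \<Rightarrow> int set" where
  "SLCE_set \<alpha> = {j \<in> carrier (Zmod (CARD('a) - 1)). SLCE_seq \<alpha> (nat j) = 1}"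

definition is_multiplier :: "nat \<Rightarrow> int set \<Rightarrow> int \<Rightarrow> bool" where
  "is_multiplier n S t \<longleftrightarrow> t \<in> carrier (Zmod_units n) \<and>
     (\<exists>c \<in> carrier (Zmod n). (\<lambda>j. t \<otimes>\<^bsub>Zmod n\<^esub> j) ` S = (\<lambda>j. j \<oplus>\<^bsub>Zmod n\<^esub> c) ` S)"

definition coset_representatives :: "('g, 'b) monoid_scheme \<Rightarrow> 'g set \<Rightarrow> 'g set \<Rightarrow> bool" where
  "coset_representatives G H T \<longleftrightarrow>
     T \<subseteq> carrier G \<and> (\<forall>C \<in> rcosets\<^bsub>G\<^esub> H. \<exists>!x. x \<in> T \<inter> C)"

definition least_pos_rep :: "nat \<Rightarrow> int \<Rightarrow> nat" where
  "least_pos_rep n r = (LEAST k. 0 < k \<and> [int k = r] (mod int n))"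

definition S0 :: "nat \<Rightarrow> nat \<Rightarrow> int set \<Rightarrow> int set" where
  "S0 p d T =
     (let n = p ^ d - 1;
          x = (\<lambda>j i. real (least_pos_rep n (inv\<^bsub>Zmod_units n\<^esub> j)) * real p ^ i / real n)
      in {j \<in> T. int d - (\<Sum>i<d. \<lfloor>2 * x j i\<rfloor> - 2 * \<lfloor>x j i\<rfloor>) > 0})"

end

theory Submission
  imports Defs
begin

text \<open>Write \<open>Q = q - 1\<close> and \<open>h(a) = \<Sum>s\<in>S. \<alpha> ^ (s * a)\<close>, a sum in the finite field itself.  The quadratic
  character is \<open>y \<mapsto> y ^ (Q div 2)\<close>, so the binomial theorem gives
  \<open>2 * h(a) + (- 1) ^ a = (Q div 2) choose (Q - a)\<close> for \<open>0 < a < Q\<close>, and by Lucas' theorem this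
  vanishes exactly if \<open>Q - a\<close> has a base-\<open>p\<close> digit exceeding \<open>(p - 1) div 2\<close>.

  If \<open>t * S = S + c\<close>, then \<open>h(t * a) = \<alpha> ^ (c * a) * h(a)\<close>.  For \<open>j \<in> S0\<close> the left-hand side
  vanishes at \<open>a = j\<inverse>\<close>, which is odd, so \<open>2 * h(j\<inverse>) = 1\<close>.  An element of \<open>S0 \<inter> t * S0\<close> therefore
  forces \<open>c = 0\<close>.  In this case multiplication by \<open>t\<close> preserves the set of residues all of whose
  digits are at most \<open>(p - 1) div 2\<close>, and the only units with this property are the powers of
  \<open>p\<close>.  As \<open>T\<close> meets each coset of \<open>\<langle>p\<rangle>\<close> once, \<open>t = 1\<close>.\<close>

section \<open>Residues with small digits\<close>

text \<open>For a prime \<open>p = 2 * m + 1\<close> these are the lower indices \<open>x\<close> at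
  which \<open>(p ^ d - 1) div 2 choose x\<close> is nonzero modulo \<open>p\<close>, because every
  base-\<open>p\<close> digit of the upper index equals \<open>m\<close>.\<close>

definition digits_le :: "nat \<Rightarrow> nat \<Rightarrow> nat \<Rightarrow> nat set" where
  "digits_le m p d = {\<Sum>i<d. e i * p ^ i |e. \<forall>i<d. e i \<le> m}"

lemma digits_leI: "(\<And>i. i < d \<Longrightarrow> e i \<le> m) \<Longrightarrow> (\<Sum>i<d. e i * p ^ i) \<in> digits_le m p d"
  by (auto simp: digits_le_def)

lemma digit_sum_Suc:
  fixes e :: "nat \<Rightarrow> nat"
  shows "(\<Sum>i<Suc d. e i * p ^ i) = e 0 + p * (\<Sum>i<d. e (Suc i) * p ^ i)"
  by (simp only: sum.lessThan_Suc_shift sum_distrib_left)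
    (simp add: mult.left_commute)

lemma coprime_power_diff_one:
  fixes p :: nat
  assumes "p ^ d > 1"
  shows "coprime p (p ^ d - 1)"
proof -
  have "coprime (p ^ d - 1) (p ^ d)"
    using assms by (intro coprime_diff_one_left_nat) linarith
  moreover have "d > 0"
    using assms by (cases d) auto
  ultimately show ?thesis
    by (simp add: coprime_commute)
qed

lemma digit_sum_const:
  fixes p :: nat
  assumes "p > 0"
  shows "(\<Sum>i<d. (p - 1) * p ^ i) = p ^ d - 1"
proof (induction d)
  case (Suc d)
  have "(p - 1) * p ^ d = p * p ^ d - p ^ d" "p ^ d \<le> p * p ^ d" "1 \<le> p ^ d"
    using assms by (simp_all add: diff_mult_distrib)
  with Suc show ?case
    by simp
qed simp

lemma digit_sum_le:
  fixes p :: nat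
  assumes "\<And>i. i < d \<Longrightarrow> e i \<le> p - 1" "p > 0"
  shows "(\<Sum>i<d. e i * p ^ i) \<le> p ^ d - 1"
proof -
  have "(\<Sum>i<d. e i * p ^ i) \<le> (\<Sum>i<d. (p - 1) * p ^ i)"
    using assms(1) by (intro sum_mono) auto
  then show ?thesis
    using digit_sum_const[OF assms(2)] by simp
qed

lemma digit_sum_inj:
  fixes p :: nat
  assumes "\<And>i. i < d \<Longrightarrow> e i < p" "\<And>i. i < d \<Longrightarrow> f i < p"
    and "(\<Sum>i<d. e i * p ^ i) = (\<Sum>i<d. f i * p ^ i)" "i < d"
  shows "e i = f i"
  using assms
proof (induction d arbitrary: e f i)
  case (Suc d)
  have *: "e 0 + p * (\<Sum>i<d. e (Suc i) * p ^ i) = f 0 + p * (\<Sum>i<d. f (Suc i) * p ^ i)"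
    using Suc.prems(3) by (simp only: digit_sum_Suc)
  have lt: "e 0 < p" "f 0 < p"
    using Suc.prems(1,2) by auto
  have "e 0 = f 0"
    using arg_cong[OF *, of "\<lambda>x. x mod p"] lt by simp
  moreover have "(\<Sum>i<d. e (Suc i) * p ^ i) = (\<Sum>i<d. f (Suc i) * p ^ i)"
    using * \<open>e 0 = f 0\<close> lt by simp
  then have "e (Suc k) = f (Suc k)" if "k < d" for k
    using Suc.IH[of "\<lambda>i. e (Suc i)" "\<lambda>i. f (Suc i)" k] Suc.prems(1,2) that by simp
  ultimately show ?case
    using Suc.prems(4) by (cases i) auto
qed simp

text \<open>Modulo \<open>p ^ d - 1\<close> the only ambiguity in the digits is between \<open>0\<close> and \<open>p ^ d - 1\<close>.\<close>

lemma digit_sum_cong_inj: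
  fixes p :: nat
  assumes "p > 1" "\<And>i. i < d \<Longrightarrow> e i \<le> p - 1" "\<And>i. i < d \<Longrightarrow> f i \<le> p - 1"
    and c: "[(\<Sum>i<d. e i * p ^ i) = (\<Sum>i<d. f i * p ^ i)] (mod (p ^ d - 1))"
    and nz: "\<not> [(\<Sum>i<d. e i * p ^ i) = 0] (mod (p ^ d - 1))"
    and "i < d"
  shows "e i = f i"
proof -
  have below: "(\<Sum>i<d. g i * p ^ i) < p ^ d - 1"
    if "\<And>i. i < d \<Longrightarrow> g i \<le> p - 1" "\<not> [(\<Sum>i<d. g i * p ^ i) = 0] (mod (p ^ d - 1))" for g
    using digit_sum_le[of d g p] that assms(1) by (cases "(\<Sum>i<d. g i * p ^ i) = p ^ d - 1") (auto simp: cong_def)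
  have "\<not> [(\<Sum>i<d. f i * p ^ i) = 0] (mod (p ^ d - 1))"
    using c nz cong_trans by blast
  then have "(\<Sum>i<d. e i * p ^ i) = (\<Sum>i<d. f i * p ^ i)"
    using c below[of e] below[of f] assms(2,3) nz by (simp add: cong_def)
  moreover have "e i < p" "f i < p" if "i < d" for i
    using assms(1,2,3) that by (meson Suc_diff_1 le_imp_less_Suc less_trans zero_less_one
        diff_less order_le_less_trans)+
  ultimately show ?thesis
    using digit_sum_inj[of d e p f i] assms(6) by blast
qed

text \<open>As \<open>p ^ d\<close> is \<open>1\<close> modulo \<open>p ^ d - 1\<close>, multiplying
  by \<open>p\<close> rotates the \<open>d\<close> digits cyclically, and a rotation respects any
  bound on the digits.\<close>

lemma digits_le_mult_power:
  assumes "p > 0" "x \<in> digits_le m p d"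
  shows "\<exists>y\<in>digits_le m p d. [p ^ k * x = y] (mod (p ^ d - 1))"
proof (induction k)
  case 0
  then show ?case using assms(2) by (auto intro: bexI[of _ x])
next
  case (Suc k)
  have step: "\<exists>z\<in>digits_le m p d. [p * y = z] (mod (p ^ d - 1))" if y: "y \<in> digits_le m p d" for y
  proof (cases d)
    case 0
    then show ?thesis using y by (auto simp: digits_le_def)
  next
    case d: (Suc d')
    obtain e where e: "\<And>i. i < d \<Longrightarrow> e i \<le> m" "y = (\<Sum>i<d. e i * p ^ i)"
      using y by (auto simp: digits_le_def)
    \<comment> \<open>The rotated digits: the top digit wraps around to position \<open>0\<close>,
      at the cost of \<open>e d'\<close> times the modulus.\<close>
    define f where "f i = (case i of 0 \<Rightarrow> e d' | Suc i \<Rightarrow> e i)" for i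
    have "(\<Sum>i<d. f i * p ^ i) \<in> digits_le m p d"
      using e(1) d by (intro digits_leI) (auto simp: f_def split: nat.splits)
    moreover have "p * y = (\<Sum>i<d. f i * p ^ i) + e d' * (p ^ d - 1)"
    proof -
      have "(\<Sum>i<d. f i * p ^ i) = e d' + p * (\<Sum>i<d'. e i * p ^ i)"
        unfolding d digit_sum_Suc by (simp add: f_def)
      moreover have "p * y = p * (\<Sum>i<d'. e i * p ^ i) + e d' * p ^ d"
        by (simp add: e(2) d algebra_simps)
      moreover have "e d' * p ^ d = e d' + e d' * (p ^ d - 1)"
        using assms(1) by (metis Suc_pred' mult_Suc_right zero_less_power)
      ultimately show ?thesis by simp
    qed
    then have "[p * y = (\<Sum>i<d. f i * p ^ i)] (mod (p ^ d - 1))"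
      by (simp add: cong_def)
    ultimately show ?thesis by blast
  qed
  from Suc obtain y where y: "y \<in> digits_le m p d" "[p ^ k * x = y] (mod (p ^ d - 1))" by blast
  from step[OF y(1)] obtain z where z: "z \<in> digits_le m p d" "[p * y = z] (mod (p ^ d - 1))" by blast
  have "[p ^ Suc k * x = p * y] (mod (p ^ d - 1))"
    using cong_scalar_left[OF y(2), of p] by (simp add: mult.assoc)
  then show ?case using z cong_trans by blast
qed

text \<open>The digits of the residues \<open>t * p ^ j\<close> form a \<open>d\<close> by
  \<open>d\<close> matrix of natural numbers. Its column sums are at most \<open>1\<close> and no
  row is zero, so counting entries leaves a single \<open>1\<close> in each row. Row
  \<open>0\<close> then exhibits \<open>t\<close> as a power of \<open>p\<close>.\<close>

lemma stabilizer_digits_le: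
  fixes p m d t :: nat
  assumes p: "p = 2 * m + 1" "m > 0" and d: "d > 0"
    and t: "coprime t (p ^ d - 1)"
    and stab: "\<And>x. x \<in> digits_le m p d \<Longrightarrow> \<exists>y\<in>digits_le m p d. [t * x = y] (mod (p ^ d - 1))"
  shows "\<exists>k. [t = p ^ k] (mod (p ^ d - 1))"
proof -
  define Q where "Q = p ^ d - 1"
  define val where "val e = (\<Sum>i<d. e i * p ^ i)" for e
  have p1: "p > 1" and p1m: "p - 1 = 2 * m"
    using p by auto
  have val_add: "val (\<lambda>i. e i + f i) = val e + val f" for e f
    by (simp add: val_def distrib_right sum.distrib)
  have val_unit: "val (\<lambda>i. if i = j then 1 else 0) = p ^ j" if "j < d" for j
    using that by (simp add: val_def if_distrib[of "\<lambda>x. x * _"] cong: if_cong)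
  \<comment> \<open>Every digit of \<open>Q\<close> is \<open>p - 1 = 2 * m\<close>, so digits
    bounded by \<open>m\<close> give a value of at most half of \<open>Q\<close>.\<close>
  have Qm: "Q = 2 * val (\<lambda>_. m)"
    using digit_sum_const[of p d] p1 unfolding Q_def val_def p1m by (simp add: sum_distrib_left mult.assoc)
  have "p ^ d \<ge> p ^ 1"
    using d p1 by (intro power_increasing) auto
  then have Q2: "Q \<ge> 2"
    using p by (simp add: Q_def)
  have val_le: "val e < Q" if "\<And>i. i < d \<Longrightarrow> e i \<le> m" for e
  proof -
    have "val e \<le> val (\<lambda>_. m)"
      unfolding val_def using that by (intro sum_mono) auto
    then show ?thesis using Qm Q2 by linarith
  qed
  have stab': "\<exists>f. (\<forall>i<d. f i \<le> m) \<and> [t * val e = val f] (mod Q)" if "\<And>i. i < d \<Longrightarrow> e i \<le> m" for e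
    using stab[OF digits_leI[of d e m p, OF that]] unfolding digits_le_def val_def Q_def by blast
  have "\<exists>f. (\<forall>i<d. f i \<le> m) \<and> [t * p ^ j = val f] (mod Q)" if "j < d" for j
    using stab'[of "\<lambda>i. if i = j then 1 else 0"] val_unit[OF that] p(2) by auto
  then obtain \<tau> where \<tau>: "\<And>i j. j < d \<Longrightarrow> i < d \<Longrightarrow> \<tau> j i \<le> m"
    and \<tau>_cong: "\<And>j. j < d \<Longrightarrow> [t * p ^ j = val (\<tau> j)] (mod Q)"
    by metis
  \<comment> \<open>The digits of \<open>t * val e\<close> predicted by linearity, before any
    carrying; a priori they may exceed \<open>p - 1\<close>.\<close>
  define conv where "conv e k = (\<Sum>j<d. e j * \<tau> j k)" for e k
  have val_conv: "[t * val e = val (conv e)] (mod Q)" for e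
  proof -
    have "t * val e = (\<Sum>j<d. e j * (t * p ^ j))"
      by (simp add: val_def sum_distrib_left mult_ac)
    also have "[\<dots> = (\<Sum>j<d. e j * val (\<tau> j))] (mod Q)"
      by (intro cong_sum cong_scalar_left \<tau>_cong) auto
    also have "(\<Sum>j<d. e j * val (\<tau> j)) = (\<Sum>j<d. \<Sum>i<d. e j * (\<tau> j i * p ^ i))"
      by (simp add: val_def sum_distrib_left)
    also have "\<dots> = (\<Sum>i<d. \<Sum>j<d. e j * (\<tau> j i * p ^ i))"
      by (rule sum.swap)
    also have "\<dots> = val (conv e)"
      by (simp add: val_def conv_def sum_distrib_right mult.assoc)
    finally show ?thesis .
  qed
  text \<open>Raising one digit of \<open>e\<close> by one keeps all digits of \<open>conv e\<close> at most \<open>2 * m = p - 1\<close>, so no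
    carries occur and they can be compared with the digits supplied by \<open>stab\<close>.\<close>
  have conv_le: "\<forall>k<d. conv e k \<le> m" if "\<And>i. i < d \<Longrightarrow> e i \<le> m" for e
    using that
  proof (induction "\<Sum>i<d. e i" arbitrary: e)
    case 0
    then show ?case by (simp add: conv_def)
  next
    case (Suc s)
    have "\<exists>j<d. e j > 0"
    proof (rule ccontr)
      assume "\<not> (\<exists>j<d. e j > 0)"
      then have "(\<Sum>i<d. e i) = 0" by simp
      then show False using Suc.hyps(2) by simp
    qed
    then obtain j where j: "j < d" "e j > 0" by blast
    define e' where "e' = e(j := e j - 1)"
    have e_eq: "e = (\<lambda>i. e' i + (if i = j then 1 else 0))"
      using j by (auto simp: e'_def)
    have "(\<Sum>i<d. e i) = (\<Sum>i<d. e' i) + 1"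
      using j by (subst e_eq) (simp add: sum.distrib)
    moreover have "e' i \<le> m" if "i < d" for i
      using Suc.prems[OF that] by (auto simp: e'_def)
    ultimately have IH: "\<forall>k<d. conv e' k \<le> m"
      using Suc.hyps(1)[of e'] Suc.hyps(2) by simp
    have conv_e: "conv e k = conv e' k + \<tau> j k" for k
      using j by (subst e_eq) (simp add: conv_def distrib_right sum.distrib if_distrib[of "\<lambda>x. x * _"] cong: if_cong)
    have le: "conv e k \<le> p - 1" if "k < d" for k
      using IH \<tau>[OF j(1) that] that unfolding conv_e p1m by fastforce
    obtain f where f: "\<forall>i<d. f i \<le> m" "[t * val e = val f] (mod Q)"
      using stab'[of e] Suc.prems by blast
    \<comment> \<open>Being nonzero modulo \<open>Q\<close> excludes the one ambiguity, all digits
      \<open>0\<close> against all digits \<open>p - 1\<close>.\<close>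
    have "val e > 0"
      using j p1 by (auto simp: val_def sum_nonneg_eq_0_iff intro!: gr0I)
    then have "\<not> [val e = 0] (mod Q)"
      using val_le[of e] Suc.prems by (simp add: cong_def)
    then have "\<not> [t * val e = 0] (mod Q)"
      using t by (simp add: Q_def cong_0_iff coprime_dvd_mult_right_iff coprime_commute)
    then have "\<not> [val (conv e) = 0] (mod Q)"
      using val_conv cong_trans by blast
    moreover have "[val (conv e) = val f] (mod Q)"
      using val_conv f(2) cong_trans cong_sym by blast
    moreover have "f i \<le> p - 1" if "i < d" for i
      using f(1) that p1m by fastforce
    ultimately have "conv e i = f i" if "i < d" for i
      using digit_sum_cong_inj[of p d "conv e" f i] p1 le that unfolding val_def Q_def by blast
    then show ?case using f(1) by simp
  qed
  \<comment> \<open>With all digits equal to \<open>m\<close>, the bound reads \<open>m\<close>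
    times the column sum is at most \<open>m\<close>.\<close>
  have col: "(\<Sum>j<d. \<tau> j k) \<le> 1" if "k < d" for k
    using conv_le[of "\<lambda>_. m"] that p(2) by (auto simp: conv_def simp flip: sum_distrib_left)
  \<comment> \<open>A zero row would make \<open>Q\<close> divide the unit
    \<open>t * p ^ j\<close>.\<close>
  have row: "(\<Sum>k<d. \<tau> j k) \<ge> 1" if "j < d" for j
  proof (rule ccontr)
    assume "\<not> ?thesis"
    then have "\<forall>k<d. \<tau> j k = 0" by (simp add: not_le)
    then have "val (\<tau> j) = 0" by (simp add: val_def)
    then have "[t * p ^ j = 0] (mod Q)" using \<tau>_cong[OF that] by simp
    moreover have "coprime p Q"
      using coprime_power_diff_one[of p d] one_less_power[OF p1 d] by (simp add: Q_def)
    ultimately show False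
      using t Q2 coprime_common_divisor[of t Q Q]
      by (simp add: Q_def cong_0_iff coprime_dvd_mult_left_iff coprime_commute)
  qed
  have "(\<Sum>k<d. \<tau> 0 k) \<le> 1"
  proof (rule ccontr)
    assume "\<not> ?thesis"
    then have "(\<Sum>j<d. 1) < (\<Sum>j<d. \<Sum>k<d. \<tau> j k)"
      using d row by (intro sum_strict_mono_ex1) (auto intro!: bexI[of _ 0])
    also have "\<dots> = (\<Sum>k<d. \<Sum>j<d. \<tau> j k)" by (rule sum.swap)
    also have "\<dots> \<le> (\<Sum>k<d. 1)" using col by (intro sum_mono) auto
    finally show False by simp
  qed
  then have sum1: "(\<Sum>k<d. \<tau> 0 k) = 1" using row[OF d] by simp
  then obtain k where k: "k < d" "\<tau> 0 k = 1" "\<And>i. i < d \<Longrightarrow> i \<noteq> k \<Longrightarrow> \<tau> 0 i = 0"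
    using sum_eq_1_iff[of "{..<d}" "\<tau> 0"] by auto
  then have "val (\<tau> 0) = val (\<lambda>i. if i = k then 1 else 0)"
    unfolding val_def by (intro sum.cong) auto
  then show ?thesis
    using \<tau>_cong[OF d] val_unit[OF k(1)] unfolding Q_def by auto
qed

section \<open>Lucas' theorem for binomial coefficients modulo a prime\<close>

text \<open>This is Lucas' theorem for one digit. Each increase of \<open>n\<close> multiplies
  \<open>(1 + X) ^ (p * n + m)\<close> by \<open>(1 + X) ^ p\<close>, which is
  \<open>1 + X ^ p\<close> modulo \<open>p\<close>; on coefficients this becomes Pascal's rule for
  \<open>n\<close> and \<open>k\<close>.\<close>

lemma choose_mult_add_cong:
  fixes p :: nat
  assumes "prime p" "m < p" "j < p"
  shows "[(p * n + m) choose (p * k + j) = (n choose k) * (m choose j)] (mod p)"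
proof (induction n arbitrary: k)
  case 0
  have "m < p * k + j" if "k > 0"
    using that assms(2) by (cases k) auto
  then show ?case
    by (cases "k = 0") (simp_all add: binomial_eq_0)
next
  case (Suc n)
  have key: "[(p + M) choose s = (M choose s) + (if p \<le> s then M choose (s - p) else 0)] (mod p)" for M s
  proof -
    \<comment> \<open>In Vandermonde's sum only \<open>i = 0\<close> and \<open>i = p\<close>
      survive modulo \<open>p\<close>; the intersection drops \<open>p\<close> if it exceeds
      \<open>s\<close>.\<close>
    define A where "A = {0, p} \<inter> {..s}"
    have "(p + M) choose s = (\<Sum>i\<le>s. (p choose i) * (M choose (s - i)))"
      by (rule vandermonde[symmetric])
    also have "[\<dots> = (\<Sum>i\<le>s. if i \<in> A then (p choose i) * (M choose (s - i)) else 0)] (mod p)"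
    proof (rule cong_sum)
      fix i assume i: "i \<in> {..s}"
      show "[(p choose i) * (M choose (s - i)) =
          (if i \<in> A then (p choose i) * (M choose (s - i)) else 0)] (mod p)"
      proof (cases "i \<in> A")
        case False
        then have "i \<noteq> 0" "i \<noteq> p" using i by (auto simp: A_def)
        then have "p dvd (p choose i)"
          using assms(1) by (cases "i < p") (auto intro!: dvd_choose_prime simp: binomial_eq_0)
        then show ?thesis using False by (auto simp: cong_0_iff)
      qed simp
    qed
    also have "(\<Sum>i\<le>s. if i \<in> A then (p choose i) * (M choose (s - i)) else 0)
        = (\<Sum>i\<in>A. (p choose i) * (M choose (s - i)))"
      by (subst sum.inter_restrict[symmetric]) (auto simp: A_def Int_absorb1 Int_commute)
    also have "\<dots> = (M choose s) + (if p \<le> s then M choose (s - p) else 0)"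
      using prime_gt_0_nat[OF assms(1)] by (auto simp: A_def)
    finally show ?thesis .
  qed
  have "[(p * Suc n + m) choose (p * k + j) = ((p * n + m) choose (p * k + j)) +
      (if p \<le> p * k + j then (p * n + m) choose (p * k + j - p) else 0)] (mod p)"
    using key[of "p * n + m" "p * k + j"] by (simp add: add.assoc)
  also have "[((p * n + m) choose (p * k + j)) +
      (if p \<le> p * k + j then (p * n + m) choose (p * k + j - p) else 0)
    = (n choose k) * (m choose j) + (case k of 0 \<Rightarrow> 0 | Suc k' \<Rightarrow> (n choose k') * (m choose j))] (mod p)"
  proof (cases k)
    case 0
    then show ?thesis using Suc.IH[of 0] assms(3) by simp
  next
    case (Suc k')
    then show ?thesis using cong_add[OF Suc.IH[of k] Suc.IH[of k']] by simp
  qed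
  also have "(n choose k) * (m choose j) + (case k of 0 \<Rightarrow> 0 | Suc k' \<Rightarrow> (n choose k') * (m choose j))
      = (Suc n choose k) * (m choose j)"
    by (cases k) (auto simp: algebra_simps)
  finally show ?case .
qed

text \<open>Splitting off the lowest digit of \<open>x\<close> leaves the factor
  \<open>m choose (x mod p)\<close>. For a digit up to \<open>m\<close> it divides
  \<open>fact m\<close>, which is prime to \<open>p\<close> as \<open>m < p\<close>; for a larger
  digit it is zero.\<close>

lemma not_dvd_choose_iff_digits_le:
  fixes p :: nat
  assumes "prime p" "m < p"
  shows "\<not> p dvd ((\<Sum>i<d. m * p ^ i) choose x) \<longleftrightarrow> x \<in> digits_le m p d"
proof (induction d arbitrary: x)
  case 0
  show ?case using assms by (cases x) (auto simp: digits_le_def)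
next
  case (Suc d)
  define N where "N = (\<Sum>i<d. m * p ^ i)"
  have pp: "p > 0" using assms by simp
  have "[(p * N + m) choose (p * (x div p) + x mod p) = (N choose (x div p)) * (m choose (x mod p))] (mod p)"
    using assms pp by (intro choose_mult_add_cong) auto
  then have "p dvd ((\<Sum>i<Suc d. m * p ^ i) choose x) \<longleftrightarrow> p dvd (N choose (x div p)) * (m choose (x mod p))"
    unfolding digit_sum_Suc N_def[symmetric] by (simp add: add.commute cong_dvd_iff)
  also have "\<dots> \<longleftrightarrow> p dvd (N choose (x div p)) \<or> m < x mod p"
  proof -
    have "\<not> p dvd (m choose k)" if "k \<le> m" for k
      using that assms by (metis binomial_fact_lemma dvd_mult prime_dvd_fact_iff not_less)
    then have "p dvd (m choose (x mod p)) \<longleftrightarrow> m < x mod p"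
      by (cases "m < x mod p") (auto simp: binomial_eq_0)
    then show ?thesis using assms(1) by (simp add: prime_dvd_mult_iff)
  qed
  finally have "\<not> p dvd ((\<Sum>i<Suc d. m * p ^ i) choose x) \<longleftrightarrow> x div p \<in> digits_le m p d \<and> x mod p \<le> m"
    using Suc.IH[of "x div p"] by (auto simp: N_def)
  also have "\<dots> \<longleftrightarrow> x \<in> digits_le m p (Suc d)"
  proof
    assume "x div p \<in> digits_le m p d \<and> x mod p \<le> m"
    then obtain e where e: "\<forall>i<d. e i \<le> m" "x div p = (\<Sum>i<d. e i * p ^ i)" "x mod p \<le> m"
      by (auto simp: digits_le_def)
    define f where "f i = (case i of 0 \<Rightarrow> x mod p | Suc i \<Rightarrow> e i)" for i
    have "(\<Sum>i<Suc d. f i * p ^ i) = x mod p + p * (x div p)"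
      unfolding digit_sum_Suc e(2) by (simp add: f_def)
    moreover have "(\<Sum>i<Suc d. f i * p ^ i) \<in> digits_le m p (Suc d)"
      using e by (intro digits_leI) (auto simp: f_def split: nat.splits)
    ultimately show "x \<in> digits_le m p (Suc d)" by simp
  next
    assume "x \<in> digits_le m p (Suc d)"
    then obtain e where e: "\<forall>i<Suc d. e i \<le> m" "x = (\<Sum>i<Suc d. e i * p ^ i)"
      by (auto simp: digits_le_def)
    have x: "x = e 0 + p * (\<Sum>i<d. e (Suc i) * p ^ i)"
      using e(2) by (simp only: digit_sum_Suc)
    moreover have "e 0 < p" "e 0 \<le> m" using e(1) assms(2) by (auto intro: le_less_trans)
    ultimately have "x mod p = e 0" "x div p = (\<Sum>i<d. e (Suc i) * p ^ i)" by simp_all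
    then show "x div p \<in> digits_le m p d \<and> x mod p \<le> m"
      using e(1) \<open>e 0 \<le> m\<close> by (auto intro!: digits_leI)
  qed
  finally show ?case .
qed

section \<open>Exponential sums over the SLCE set\<close>

context
  fixes \<alpha> :: "'a::{field,finite}" and Q :: nat
  assumes prim: "primitive_element \<alpha>" and Q: "Q = CARD('a) - 1"
begin

lemma primitive_nonzero: "\<alpha> \<noteq> 0"
proof -
  have "\<alpha> ^ 1 \<in> UNIV - {0}"
    using prim unfolding primitive_element_def by blast
  then show ?thesis by simp
qed

lemma card_nonzero: "card (UNIV - {0 :: 'a}) = Q"
  by (simp add: Q)

lemma order_pos: "Q > 0"
proof -
  have "(1 :: 'a) \<in> UNIV - {0}" by simp
  then have "UNIV - {0 :: 'a} \<noteq> {}" by (rule ex_in_conv[THEN iffD1, OF exI])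
  then have "card (UNIV - {0 :: 'a}) > 0"
    by (intro card_gt_0_iff[THEN iffD2] conjI finite)
  then show ?thesis by (simp only: card_nonzero)
qed

text \<open>By pigeonhole some \<open>r\<close> with \<open>0 < r \<le> Q\<close> satisfies
  \<open>\<alpha> ^ r = 1\<close>. The first \<open>r\<close> powers then exhaust all nonzero
  elements, and counting these forces \<open>r = Q\<close>.\<close>

lemma primitive_power_Q: "\<alpha> ^ Q = 1" and primitive_image: "(\<lambda>k. \<alpha> ^ k) ` {..<Q} = UNIV - {0}"
proof -
  have "\<not> inj_on (\<lambda>k. \<alpha> ^ k) {..Q}"
  proof
    assume "inj_on (\<lambda>k. \<alpha> ^ k) {..Q}"
    then have "card {..Q} \<le> card (UNIV - {0 :: 'a})"
      by (rule card_inj_on_le) (auto simp: primitive_nonzero)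
    then show False using card_nonzero by simp
  qed
  then obtain i j where ij: "i < j" "j \<le> Q" "\<alpha> ^ i = \<alpha> ^ j"
    by (metis atMost_iff inj_onI linorder_neqE_nat)
  define r where "r = j - i"
  have r: "r > 0" "r \<le> Q" "\<alpha> ^ r = 1"
    using ij primitive_nonzero by (auto simp: r_def power_diff)
  have "range (\<lambda>k::nat. \<alpha> ^ k) \<subseteq> (\<lambda>k. \<alpha> ^ k) ` {..<r}"
  proof (intro image_subsetI)
    fix k
    have "\<alpha> ^ k = \<alpha> ^ (r * (k div r) + k mod r)" by simp
    also have "\<dots> = \<alpha> ^ (k mod r)" by (simp only: power_add power_mult r power_one mult_1)
    finally show "\<alpha> ^ k \<in> (\<lambda>k. \<alpha> ^ k) ` {..<r}" using r by auto
  qed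
  then have im: "(\<lambda>k. \<alpha> ^ k) ` {..<r} = UNIV - {0}"
    using prim unfolding primitive_element_def by (metis image_mono subset_UNIV subset_antisym)
  have "Q \<le> r"
    using card_image_le[of "{..<r}" "\<lambda>k. \<alpha> ^ k"] unfolding im card_nonzero by simp
  then have "r = Q" using r by simp
  with r im show "\<alpha> ^ Q = 1" "(\<lambda>k. \<alpha> ^ k) ` {..<Q} = UNIV - {0}" by auto
qed

lemma primitive_power_mod: "\<alpha> ^ (k mod Q) = \<alpha> ^ k"
proof -
  have "\<alpha> ^ k = \<alpha> ^ (Q * (k div Q) + k mod Q)" by simp
  then show ?thesis by (simp only: power_add power_mult primitive_power_Q power_one mult_1)
qed

lemma primitive_inj: "inj_on (\<lambda>k. \<alpha> ^ k) {..<Q}"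
  by (rule eq_card_imp_inj_on) (simp_all add: primitive_image card_nonzero)

lemma primitive_power_eq_1_iff: "\<alpha> ^ k = 1 \<longleftrightarrow> Q dvd k"
proof
  assume "\<alpha> ^ k = 1"
  then have "\<alpha> ^ (k mod Q) = \<alpha> ^ 0" by (simp add: primitive_power_mod)
  then have "k mod Q = 0"
    using order_pos by (intro inj_onD[OF primitive_inj]) auto
  then show "Q dvd k" by auto
qed (auto simp: power_mult primitive_power_Q)

text \<open>The sum is a geometric series in \<open>\<alpha> ^ k\<close>. If \<open>Q\<close>
  divides \<open>k\<close>, all its \<open>Q\<close> terms are \<open>1\<close>, and
  \<open>Q = - 1\<close> in the field because the characteristic divides the cardinality.\<close>

lemma sum_nonzero_power:
  "(\<Sum>x\<in>UNIV - {0 :: 'a}. x ^ k) = (if Q dvd k then - 1 else 0)"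
proof -
  have "(\<Sum>x\<in>UNIV - {0 :: 'a}. x ^ k) = (\<Sum>j<Q. (\<alpha> ^ j) ^ k)"
    unfolding primitive_image[symmetric] by (subst sum.reindex[OF primitive_inj]) simp
  also have "\<dots> = (\<Sum>j<Q. (\<alpha> ^ k) ^ j)"
    by (simp add: mult.commute flip: power_mult)
  also have "\<dots> = (if Q dvd k then - 1 else 0)"
  proof (cases "Q dvd k")
    case True
    have "of_nat (CARD('a)) = (0 :: 'a)"
      using CHAR_dvd_CARD by (simp add: of_nat_eq_0_iff_char_dvd)
    then have "of_nat Q = (- 1 :: 'a)"
      using order_pos by (simp add: Q of_nat_diff)
    then show ?thesis
      using True by (simp add: primitive_power_eq_1_iff[THEN iffD2])
  next
    case False
    then have ne: "\<alpha> ^ k \<noteq> 1" by (simp add: primitive_power_eq_1_iff)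
    have "(\<alpha> ^ k) ^ Q = 1"
      by (metis power_mult mult.commute primitive_power_Q power_one)
    then show ?thesis
      using False geometric_sum[OF ne, of Q] by simp
  qed
  finally show ?thesis .
qed

text \<open>Euler's criterion: \<open>\<alpha> ^ N\<close> is a square root of \<open>1\<close>
  other than \<open>1\<close>, hence \<open>- 1\<close>, and the squares are the even powers of
  \<open>\<alpha>\<close>.\<close>

lemma quadratic_character:
  assumes ev: "Q = 2 * N" and two: "(2 :: 'a) \<noteq> 0" and y: "(y :: 'a) \<noteq> 0"
  shows "y ^ N = (if is_nth_power 2 y then 1 else - 1)"
proof -
  have "(\<alpha> ^ N)\<^sup>2 = 1"
    using primitive_power_Q by (simp add: ev mult.commute flip: power_mult)
  moreover have "\<alpha> ^ N \<noteq> 1"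
    using order_pos ev by (auto simp: primitive_power_eq_1_iff dest: dvd_imp_le)
  ultimately have gN: "\<alpha> ^ N = - 1"
    by (simp add: power2_eq_1_iff)
  have pow: "(\<alpha> ^ k) ^ N = (- 1) ^ k" for k
    by (metis gN power_mult mult.commute)
  obtain k where k: "y = \<alpha> ^ k"
    using y prim unfolding primitive_element_def by blast
  show ?thesis
  proof (cases "is_nth_power 2 y")
    case True
    then obtain z where z: "y = z ^ 2" by (auto simp: is_nth_power_def)
    then have "z \<in> range (\<lambda>k::nat. \<alpha> ^ k)"
      using y prim unfolding primitive_element_def by auto
    then obtain l where "z = \<alpha> ^ l" by blast
    then have "y = \<alpha> ^ (l * 2)" using z by (simp add: power_mult)
    then show ?thesis using True pow[of "l * 2"] by simp
  next
    case False
    then have "odd k" using k by (auto simp: power_mult is_nth_power_def elim!: evenE simp: mult.commute[of 2])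
    then show ?thesis using False k pow by simp
  qed
qed

text \<open>The Fourier transform of the indicator of the SLCE set, with values in the field: since
  \<open>\<alpha>\<close> has order \<open>Q\<close>, the map from \<open>s\<close> to
  \<open>\<alpha> ^ (s * a)\<close> is a character of the integers modulo \<open>Q\<close>.\<close>

definition exp_sum :: "nat \<Rightarrow> 'a" where
  "exp_sum a = (\<Sum>s\<in>SLCE_set \<alpha>. \<alpha> ^ (nat s * a))"

lemma mem_SLCE_set:
  "int j \<in> SLCE_set \<alpha> \<longleftrightarrow> j < Q \<and> \<not> is_nth_power 2 (\<alpha> ^ j + 1)"
  unfolding SLCE_set_def SLCE_seq_def Q[symmetric]
  by (cases "j < Q") (simp_all add: residue_ring_def)

lemma exp_sum_eq: "exp_sum a = (\<Sum>j<Q. if is_nth_power 2 (\<alpha> ^ j + 1) then 0 else \<alpha> ^ (j * a))"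
proof -
  have "SLCE_set \<alpha> = int ` {j \<in> {..<Q}. \<not> is_nth_power 2 (\<alpha> ^ j + 1)}"
  proof (intro equalityI subsetI)
    fix s assume s: "s \<in> SLCE_set \<alpha>"
    then have "s = int (nat s)" by (simp add: SLCE_set_def residue_ring_def)
    then show "s \<in> int ` {j \<in> {..<Q}. \<not> is_nth_power 2 (\<alpha> ^ j + 1)}"
      using s mem_SLCE_set[of "nat s"] by (intro image_eqI[of _ _ "nat s"]) auto
  qed (auto simp: mem_SLCE_set)
  then have "exp_sum a = (\<Sum>j\<in>{j \<in> {..<Q}. \<not> is_nth_power 2 (\<alpha> ^ j + 1)}. \<alpha> ^ (j * a))"
    unfolding exp_sum_def by (simp add: sum.reindex)
  also have "\<dots> = (\<Sum>j<Q. if \<not> is_nth_power 2 (\<alpha> ^ j + 1) then \<alpha> ^ (j * a) else 0)"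
    by (subst sum.inter_filter[symmetric]) auto
  also have "\<dots> = (\<Sum>j<Q. if is_nth_power 2 (\<alpha> ^ j + 1) then 0 else \<alpha> ^ (j * a))"
    by (intro sum.cong) auto
  finally show ?thesis .
qed

text \<open>The sum \<open>\<Sum>x\<noteq>0. x ^ a * (x + 1) ^ N\<close> is evaluated twice: by the quadratic character,
  where the vanishing term \<open>x = - 1\<close> contributes \<open>(- 1) ^ a\<close>, and by the binomial theorem, where
  only the exponent \<open>a + k = Q\<close> survives.\<close>

lemma exp_sum_binomial:
  assumes ev: "Q = 2 * N" and two: "(2 :: 'a) \<noteq> 0" and a: "0 < a" "a < Q"
  shows "2 * exp_sum a + (- 1) ^ a = of_nat (N choose (Q - a))"
proof -
  have N: "N > 0" using order_pos ev by simp
  have "(\<Sum>x\<in>UNIV - {0 :: 'a}. x ^ a * (x + 1) ^ N) = - of_nat (N choose (Q - a))"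
  proof -
    have "(\<Sum>x\<in>UNIV - {0 :: 'a}. x ^ a * (x + 1) ^ N)
        = (\<Sum>x\<in>UNIV - {0 :: 'a}. \<Sum>k\<le>N. of_nat (N choose k) * x ^ (a + k))"
      by (intro sum.cong) (simp_all add: binomial_ring sum_distrib_left power_add mult_ac)
    also have "\<dots> = (\<Sum>k\<le>N. of_nat (N choose k) * (\<Sum>x\<in>UNIV - {0 :: 'a}. x ^ (a + k)))"
      by (subst sum.swap) (simp add: sum_distrib_left)
    also have "\<dots> = (\<Sum>k\<le>N. if k = Q - a then - of_nat (N choose k) else 0)"
    proof (intro sum.cong refl)
      fix k assume k: "k \<in> {..N}"
      have "Q dvd a + k \<longleftrightarrow> k = Q - a"
      proof
        assume "Q dvd a + k"
        then obtain c where c: "a + k = Q * c" by (auto elim: dvdE)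
        have "a + k < Q * 2" "a + k > 0" using k a ev N by auto
        then have "c < 2" "c > 0" unfolding c by auto
        then have "c = 1" by simp
        then show "k = Q - a" using c by simp
      qed (use a in simp)
      then show "of_nat (N choose k) * (\<Sum>x\<in>UNIV - {0 :: 'a}. x ^ (a + k))
          = (if k = Q - a then - of_nat (N choose k) else 0)"
        by (simp add: sum_nonzero_power)
    qed
    \<comment> \<open>If \<open>Q - a > N\<close>, no index matches, but then the binomial
      coefficient is zero as well.\<close>
    also have "\<dots> = - of_nat (N choose (Q - a))"
      by (simp add: binomial_eq_0)
    finally show ?thesis .
  qed
  moreover have "(\<Sum>x\<in>UNIV - {0 :: 'a}. x ^ a * (x + 1) ^ N) = - 2 * exp_sum a - (- 1) ^ a"
  proof -
    have "(\<Sum>x\<in>UNIV - {0 :: 'a}. x ^ a * (x + 1) ^ N)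
        = (\<Sum>x\<in>UNIV - {0 :: 'a}. x ^ a - 2 * (if is_nth_power 2 (x + 1) then 0 else x ^ a)
            - (if x = - 1 then (- 1) ^ a else 0))"
    proof (intro sum.cong refl)
      fix x :: 'a
      \<comment> \<open>Zero counts as a square, so at \<open>x = - 1\<close> the first two terms
        leave \<open>(- 1) ^ a\<close> where \<open>0\<close> is wanted; the last term corrects
        this.\<close>
      have "is_nth_power 2 (0 :: 'a)" by (auto simp: is_nth_power_def intro: exI[of _ 0])
      then show "x ^ a * (x + 1) ^ N = x ^ a - 2 * (if is_nth_power 2 (x + 1) then 0 else x ^ a)
            - (if x = - 1 then (- 1) ^ a else 0)"
        using quadratic_character[OF ev two, of "x + 1"] N
        by (cases "x = - 1") (simp_all add: power_0_left eq_neg_iff_add_eq_0[symmetric])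
    qed
    also have "\<dots> = (\<Sum>x\<in>UNIV - {0 :: 'a}. x ^ a)
        - 2 * (\<Sum>x\<in>UNIV - {0 :: 'a}. if is_nth_power 2 (x + 1) then 0 else x ^ a) - (- 1) ^ a"
      by (simp add: sum_subtractf sum_distrib_left)
    also have "(\<Sum>x\<in>UNIV - {0 :: 'a}. x ^ a) = 0"
      using a by (auto simp: sum_nonzero_power dest: dvd_imp_le)
    also have "(\<Sum>x\<in>UNIV - {0 :: 'a}. if is_nth_power 2 (x + 1) then 0 else x ^ a) = exp_sum a"
      unfolding primitive_image[symmetric] exp_sum_eq
      by (subst sum.reindex[OF primitive_inj]) (simp add: power_mult cong: if_cong)
    finally show ?thesis by simp
  qed
  ultimately show ?thesis by (simp add: algebra_simps)
qed

lemma exp_sum_mod: "exp_sum (a mod Q) = exp_sum a"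
  unfolding exp_sum_def
proof (intro sum.cong refl)
  fix s
  show "\<alpha> ^ (nat s * (a mod Q)) = \<alpha> ^ (nat s * a)"
    using primitive_power_mod[of "nat s * (a mod Q)"] primitive_power_mod[of "nat s * a"]
    by (simp only: mod_mult_right_eq)
qed

text \<open>The same sum is reindexed along both descriptions of the image: multiplication by
  \<open>t\<close> scales the argument, while translation by \<open>c\<close> pulls out a constant
  factor. Both maps are injective on the SLCE set.\<close>

lemma exp_sum_multiplier:
  assumes t: "0 \<le> t" "coprime t (int Q)" and c: "0 \<le> c"
    and eq: "(\<lambda>j. t \<otimes>\<^bsub>Zmod Q\<^esub> j) ` SLCE_set \<alpha> = (\<lambda>j. j \<oplus>\<^bsub>Zmod Q\<^esub> c) ` SLCE_set \<alpha>"
  shows "exp_sum (nat t * a) = \<alpha> ^ (nat c * a) * exp_sum a"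
proof -
  define S where "S = SLCE_set \<alpha>"
  have S: "0 \<le> s" "s < int Q" if "s \<in> S" for s
  proof -
    have "s \<in> {0..int Q - 1}"
      using that unfolding S_def SLCE_set_def Q[symmetric] by (simp add: residue_ring_def)
    then show "0 \<le> s" "s < int Q" by auto
  qed
  have eq': "(\<lambda>s. t * s mod int Q) ` S = (\<lambda>s. (s + c) mod int Q) ` S"
  proof -
    have "x \<otimes>\<^bsub>Zmod Q\<^esub> y = x * y mod int Q" "x \<oplus>\<^bsub>Zmod Q\<^esub> y = (x + y) mod int Q" for x y
      by (simp_all add: residue_ring_def)
    then show ?thesis using eq by (simp only: S_def)
  qed
  have eqI: "x = y" if "[x = y] (mod int Q)" "x \<in> S" "y \<in> S" for x y
    using that(1) S[OF that(2)] S[OF that(3)] by (simp add: cong_def)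
  have inj_t: "inj_on (\<lambda>s. t * s mod int Q) S"
  proof (intro inj_onI)
    fix x y assume "x \<in> S" "y \<in> S" "t * x mod int Q = t * y mod int Q"
    then show "x = y"
      using t(2) eqI[of x y] cong_mult_lcancel[of t "int Q" x y] by (simp add: cong_def)
  qed
  have inj_c: "inj_on (\<lambda>s. (s + c) mod int Q) S"
  proof (intro inj_onI)
    fix x y assume "x \<in> S" "y \<in> S" "(x + c) mod int Q = (y + c) mod int Q"
    then show "x = y"
      using eqI[of x y] cong_add_rcancel[of x c y "int Q"] by (simp add: cong_def)
  qed
  have pow: "\<alpha> ^ (nat (x mod int Q) * a) = \<alpha> ^ (nat x * a)" if "x \<ge> 0" for x
  proof -
    have "\<alpha> ^ (nat (x mod int Q) * a) = \<alpha> ^ ((nat x mod Q) * a mod Q)"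
      using that by (simp only: primitive_power_mod nat_mod_distrib nat_int of_nat_0_le_iff)
    then show ?thesis
      by (simp only: mod_mult_left_eq primitive_power_mod)
  qed
  have "exp_sum (nat t * a) = (\<Sum>s\<in>S. \<alpha> ^ (nat (t * s mod int Q) * a))"
    unfolding exp_sum_def S_def[symmetric]
  proof (intro sum.cong refl)
    fix s assume "s \<in> S"
    then have "nat s * (nat t * a) = nat (t * s) * a"
      using t by (simp add: nat_mult_distrib)
    then show "\<alpha> ^ (nat s * (nat t * a)) = \<alpha> ^ (nat (t * s mod int Q) * a)"
      using S[OF \<open>s \<in> S\<close>] t by (simp only: pow mult_nonneg_nonneg)
  qed
  also have "\<dots> = (\<Sum>x\<in>(\<lambda>s. t * s mod int Q) ` S. \<alpha> ^ (nat x * a))"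
    by (subst sum.reindex[OF inj_t]) simp
  also have "\<dots> = (\<Sum>s\<in>S. \<alpha> ^ (nat ((s + c) mod int Q) * a))"
    unfolding eq' by (subst sum.reindex[OF inj_c]) simp
  also have "\<dots> = (\<Sum>s\<in>S. \<alpha> ^ (nat c * a) * \<alpha> ^ (nat s * a))"
  proof (intro sum.cong refl)
    fix s assume "s \<in> S"
    then have "nat (s + c) * a = nat c * a + nat s * a"
      using S[OF \<open>s \<in> S\<close>] c by (simp add: nat_add_distrib distrib_right)
    then show "\<alpha> ^ (nat ((s + c) mod int Q) * a) = \<alpha> ^ (nat c * a) * \<alpha> ^ (nat s * a)"
      using S[OF \<open>s \<in> S\<close>] c by (simp only: pow add_nonneg_nonneg power_add)
  qed
  also have "\<dots> = \<alpha> ^ (nat c * a) * exp_sum a"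
    by (simp add: exp_sum_def S_def sum_distrib_left)
  finally show ?thesis .
qed

end

section \<open>Zeros of the exponential sums in characteristic \<open>p\<close>\<close>

lemma CHAR_eq_prime:
  assumes "prime p" "CARD('a::{field,finite}) = p ^ d"
  shows "CHAR('a) = p"
proof -
  have "CHAR('a) > 0" by (rule finite_imp_CHAR_pos) simp
  then have "prime CHAR('a)" by (rule prime_CHAR_semidom)
  moreover have "CHAR('a) dvd p ^ d" using CHAR_dvd_CARD[where ?'a = 'a] assms(2) by simp
  ultimately show ?thesis
    using assms(1) by (metis prime_dvd_power primes_dvd_imp_eq)
qed

text \<open>The binomial coefficient computed by \<open>exp_sum_binomial\<close> vanishes in the
  field exactly if \<open>p\<close> divides it, and its upper index has all digits \<open>m\<close>,
  so the digit criterion applies.\<close>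

lemma exp_sum_vanish_iff:
  fixes \<alpha> :: "'a::{field,finite}"
  assumes p: "prime p" "p = 2 * m + 1" and card: "CARD('a) = p ^ d"
    and \<alpha>: "primitive_element \<alpha>" and a: "0 < a" "a < p ^ d - 1"
  shows "2 * exp_sum \<alpha> a + (- 1) ^ a = 0 \<longleftrightarrow> p ^ d - 1 - a \<notin> digits_le m p d"
proof -
  have CHAR: "CHAR('a) = p" by (rule CHAR_eq_prime[OF p(1) card])
  have two: "(2 :: 'a) \<noteq> 0"
    using of_nat_eq_0_iff_char_dvd[where ?'a = 'a, of 2] p prime_gt_1_nat[OF p(1)]
    by (auto simp: CHAR dest: dvd_imp_le)
  have Q: "p ^ d - 1 = 2 * (\<Sum>i<d. m * p ^ i)"
    using digit_sum_const[of p d] by (simp add: p(2) sum_distrib_left mult.assoc)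
  have "2 * exp_sum \<alpha> a + (- 1) ^ a = (of_nat ((\<Sum>i<d. m * p ^ i) choose (p ^ d - 1 - a)) :: 'a)"
    by (rule exp_sum_binomial[OF \<alpha> _ Q two a]) (simp add: card)
  moreover have "m < p" using p(2) by simp
  ultimately show ?thesis
    using not_dvd_choose_iff_digits_le[OF p(1), of m d "p ^ d - 1 - a"]
    by (auto simp: of_nat_eq_0_iff_char_dvd CHAR)
qed

text \<open>As \<open>t\<close> is odd, invariance of \<open>exp_sum\<close> under \<open>t\<close> passes to \<open>2 * exp_sum a + (- 1) ^ a\<close>, hence to
  its zero set.\<close>

lemma multiplier_fixing_SLCE_set:
  fixes \<alpha> :: "'a::{field,finite}" and t :: nat
  assumes p: "prime p" "odd p" and d: "d > 0" and card: "CARD('a) = p ^ d"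
    and \<alpha>: "primitive_element \<alpha>" and t: "coprime t (p ^ d - 1)"
    and inv: "\<And>a. exp_sum \<alpha> (t * a) = exp_sum \<alpha> a"
  shows "\<exists>k. [t = p ^ k] (mod (p ^ d - 1))"
proof -
  obtain m where m: "p = 2 * m + 1" using p(2) by (elim oddE)
  define Q where "Q = p ^ d - 1"
  have card': "Q = CARD('a) - 1" by (simp add: Q_def card)
  have Q2: "Q = 2 * (\<Sum>i<d. m * p ^ i)"
    using digit_sum_const[of p d] by (simp add: Q_def m sum_distrib_left mult.assoc)
  have Q0: "Q > 0" by (rule order_pos[OF \<alpha> card'])
  have tQ: "coprime t Q" using t by (simp add: Q_def)
  have "odd t"
  proof
    assume "even t"
    moreover have "even Q" by (subst Q2) simp
    ultimately have "is_unit (2::nat)" using coprime_common_divisor[OF tQ] by blast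
    then show False by simp
  qed
  show ?thesis
  proof (rule stabilizer_digits_le[OF m _ d t])
    show "m > 0" using p(1) m by (cases m) auto
    fix x assume x: "x \<in> digits_le m p d"
    show "\<exists>y\<in>digits_le m p d. [t * x = y] (mod (p ^ d - 1))"
    \<comment> \<open>The value \<open>x = 0\<close> would correspond to \<open>a = Q\<close>,
      outside the range of the vanishing criterion.\<close>
    proof (cases "x = 0")
      case True
      then show ?thesis using x by (auto intro: bexI[of _ x])
    next
      case False
      have "x \<le> (\<Sum>i<d. m * p ^ i)"
        using x by (auto simp: digits_le_def intro!: sum_mono)
      then have "x < Q" using Q2 Q0 by linarith
      \<comment> \<open>The vanishing criterion speaks of \<open>Q - a\<close>; negation modulo
        \<open>Q\<close> turns multiplication of \<open>x\<close> by \<open>t\<close> into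
        multiplication of \<open>a\<close> by \<open>t\<close>.\<close>
      define a where "a = Q - x"
      define b where "b = t * a mod Q"
      have a: "0 < a" "a < Q" and xa: "x = Q - a"
        using \<open>x < Q\<close> False by (auto simp: a_def)
      have "\<not> Q dvd t * a"
        using a tQ by (auto simp: coprime_dvd_mult_right_iff coprime_commute dest: dvd_imp_le)
      then have b: "0 < b" "b < Q" using Q0 by (auto simp: b_def dvd_eq_mod_eq_0)
      have "even b \<longleftrightarrow> even (t * a)"
        unfolding b_def using Q2 by (metis dvd_mod_iff dvd_triv_left)
      then have "(- 1) ^ b = ((- 1) ^ a :: 'a)"
        using \<open>odd t\<close> by (simp add: minus_one_power_iff)
      moreover have "exp_sum \<alpha> b = exp_sum \<alpha> a"
        unfolding b_def by (simp only: exp_sum_mod[OF \<alpha> card'] inv)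
      ultimately have "Q - b \<in> digits_le m p d \<longleftrightarrow> Q - a \<in> digits_le m p d"
        using exp_sum_vanish_iff[OF p(1) m card \<alpha>, of a] exp_sum_vanish_iff[OF p(1) m card \<alpha>, of b] a b
        unfolding Q_def by simp
      then have "Q - b \<in> digits_le m p d" using x xa by simp
      moreover have "[t * x = Q - b] (mod Q)"
      proof -
        have "[t * x + t * a = Q - b + b] (mod Q)"
          using xa a b by (simp add: cong_def flip: distrib_left)
        moreover have "[t * a = b] (mod Q)" by (simp add: b_def)
        ultimately have "[t * x + b = Q - b + b] (mod Q)"
          by (metis cong_add_lcancel_nat cong_trans cong_sym)
        then show ?thesis by (simp only: cong_add_rcancel_nat)
      qed
      ultimately show ?thesis unfolding Q_def by blast
    qed
  qed
qed

section \<open>Multipliers and \<open>S0\<close>\<close>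

lemma least_pos_rep_eq:
  assumes "0 < a" "a < n"
  shows "least_pos_rep n (int a) = a"
  unfolding least_pos_rep_def
proof (rule Least_equality)
  show "0 < a \<and> [int a = int a] (mod int n)" using assms by simp
next
  fix k assume k: "0 < k \<and> [int k = int a] (mod int n)"
  then have "k mod n = a" using assms by (simp only: cong_int_iff) (simp add: cong_def)
  then show "a \<le> k" using mod_less_eq_dividend[of k n] by simp
qed

text \<open>The difference of floors is \<open>1\<close> if the fractional part of
  \<open>y / n\<close>, which is \<open>(y mod n) / n\<close>, is at least one half, and
  \<open>0\<close> otherwise.\<close>

lemma floor_defect_less_1:
  fixes y n :: nat
  assumes "n > 0" and "\<lfloor>2 * (real y / real n)\<rfloor> - 2 * \<lfloor>real y / real n\<rfloor> < 1"
  shows "2 * (y mod n) < n"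
proof (rule ccontr)
  assume "\<not> 2 * (y mod n) < n"
  then have "2 * (y div n) + 1 \<le> 2 * y div n"
  proof -
    have "2 * y = 2 * (y div n) * n + 2 * (y mod n)"
      using div_mult_mod_eq[of y n] by linarith
    then have "(2 * (y div n) + 1) * n \<le> 2 * y"
      using \<open>\<not> 2 * (y mod n) < n\<close> by simp
    then show ?thesis
      using assms(1) by (simp only: less_eq_div_iff_mult_less_eq)
  qed
  moreover have "\<lfloor>2 * (real y / real n)\<rfloor> = int (2 * y div n)"
    using floor_divide_of_nat_eq[of "2 * y" n, where ?'a = real] by simp
  ultimately show False
    using assms(2) by (simp add: floor_divide_of_nat_eq)
qed

text \<open>If all \<open>d\<close> summands were at least \<open>1\<close>, the defining difference
  could not be positive; a smaller summand marks a rotation of \<open>a\<close> below half the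
  modulus.\<close>

lemma S0_imp_small_rotation:
  assumes "p ^ d > 1" "j \<in> S0 p d T"
    and a: "inv\<^bsub>Zmod_units (p ^ d - 1)\<^esub> j = int a" "0 < a" "a < p ^ d - 1"
  shows "\<exists>i<d. 2 * (a * p ^ i mod (p ^ d - 1)) < p ^ d - 1"
proof -
  define n where "n = p ^ d - 1"
  define x where "x i = real (a * p ^ i) / real n" for i
  have "int d - (\<Sum>i<d. \<lfloor>2 * x i\<rfloor> - 2 * \<lfloor>x i\<rfloor>) > 0"
    using assms(2) least_pos_rep_eq[OF a(2,3)]
    unfolding S0_def Let_def x_def n_def a(1)[symmetric] by (simp add: a(1))
  then have "\<not> (\<forall>i\<in>{..<d}. 1 \<le> \<lfloor>2 * x i\<rfloor> - 2 * \<lfloor>x i\<rfloor>)"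
    using sum_bounded_below[of "{..<d}" 1 "\<lambda>i. \<lfloor>2 * x i\<rfloor> - 2 * \<lfloor>x i\<rfloor>"] by fastforce
  then obtain i where "i < d" "\<lfloor>2 * x i\<rfloor> - 2 * \<lfloor>x i\<rfloor> < 1" by auto
  moreover have "n > 0" using assms(1) by (simp add: n_def)
  ultimately show ?thesis
    using floor_defect_less_1[of n "a * p ^ i"] unfolding x_def n_def by blast
qed

text \<open>Otherwise the rotated complement \<open>p ^ i * (Q - a)\<close> would have a
  representative \<open>y\<close> of at most half of \<open>Q\<close>. Then \<open>y + r\<close> is
  a multiple of \<open>Q\<close> below \<open>Q\<close>, so \<open>r = 0\<close>, although
  \<open>p\<close> is a unit modulo \<open>Q\<close> and \<open>0 < a < Q\<close>.\<close>

lemma small_rotation_imp_not_digits_le: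
  fixes p :: nat
  assumes p: "p = 2 * m + 1" and pd: "p ^ d > 1" and a: "0 < a" "a < p ^ d - 1"
    and small: "2 * (a * p ^ i mod (p ^ d - 1)) < p ^ d - 1"
  shows "p ^ d - 1 - a \<notin> digits_le m p d"
proof
  define Q where "Q = p ^ d - 1"
  define r where "r = p ^ i * a mod Q"
  have Q: "Q = 2 * (\<Sum>i<d. m * p ^ i)"
    using digit_sum_const[of p d] by (simp add: Q_def p sum_distrib_left mult.assoc)
  assume "p ^ d - 1 - a \<in> digits_le m p d"
  then obtain y where y: "y \<in> digits_le m p d" "[p ^ i * (Q - a) = y] (mod Q)"
    using digits_le_mult_power[of p "p ^ d - 1 - a" m d i] p unfolding Q_def by auto
  have "y \<le> (\<Sum>i<d. m * p ^ i)"
    using y(1) by (auto simp: digits_le_def intro!: sum_mono)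
  then have less: "2 * (y + r) < 2 * Q"
    using small Q unfolding r_def Q_def[symmetric] by (simp add: mult.commute)
  have "[y + r = p ^ i * (Q - a) + p ^ i * a] (mod Q)"
    unfolding r_def by (intro cong_add cong_sym[OF y(2)]) simp
  moreover have "p ^ i * (Q - a) + p ^ i * a = p ^ i * Q"
    using a by (simp add: Q_def flip: distrib_left)
  ultimately have "Q dvd y + r"
    by (simp add: cong_dvd_iff)
  with less have "r = 0"
    by (auto dest: dvd_imp_le)
  moreover have "coprime Q (p ^ i)"
    using coprime_power_diff_one[OF pd] by (simp add: Q_def coprime_commute)
  ultimately have "Q dvd a"
    unfolding r_def by (auto simp: coprime_dvd_mult_right_iff)
  then show False using a by (auto simp: Q_def dest: dvd_imp_le)
qed

theorem theorem4p2:
  fixes \<alpha> :: "'a::{field,finite}" and p d q :: nat and S T :: "int set" and t :: int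
  assumes "prime p" and "odd p" and "d > 0" and "q = p ^ d"
    and "CARD('a) = q"
    and "primitive_element \<alpha>" and "S = SLCE_set \<alpha>"
    and "coset_representatives (Zmod_units (q - 1))
           (generate (Zmod_units (q - 1)) {int p mod int (q - 1)}) T"
    and "t \<in> T" and "is_multiplier (q - 1) S t"
  shows "(\<lambda>j. t \<otimes>\<^bsub>Zmod_units (q - 1)\<^esub> j) ` S0 p d T = S0 p d T \<or>
         (\<lambda>j. t \<otimes>\<^bsub>Zmod_units (q - 1)\<^esub> j) ` S0 p d T \<inter> S0 p d T = {}"
proof -
  define Q where "Q = q - 1"
  define G where "G = Zmod_units Q"
  define H where "H = generate G {int p mod int Q}"
  obtain m where m: "p = 2 * m + 1" using assms(2) by (elim oddE)
  have "m > 0" using assms(1) m by (cases m) auto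
  then have "p \<ge> 3" using m by simp
  moreover have "p ^ 1 \<le> p ^ d" using assms(3) \<open>p \<ge> 3\<close> by (intro power_increasing) auto
  ultimately have pd: "p ^ d \<ge> 3" by simp
  have Q: "Q > 1" "Q = p ^ d - 1" "Q = CARD('a) - 1"
    using pd assms(4,5) by (auto simp: Q_def)
  have "even Q" using assms(2) pd by (simp add: Q(2))
  interpret R: residues "int Q" "Zmod Q" using Q(1) by unfold_locales auto
  interpret G: comm_group G unfolding G_def by (rule R.units_comm_group)
  have carrier: "x \<in> carrier G \<longleftrightarrow> 0 < x \<and> x < int Q \<and> coprime x (int Q)" for x
    by (simp add: G_def units_of_carrier R.res_units_eq)
  have mult: "x \<otimes>\<^bsub>G\<^esub> y = x * y mod int Q" for x y
    by (simp add: G_def units_of_mult R.res_mult_eq)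
  have one: "\<one>\<^bsub>G\<^esub> = 1" by (simp add: G_def units_of_one R.res_one_eq)
  have T: "T \<subseteq> carrier G" and T_unique: "\<And>C. C \<in> rcosets\<^bsub>G\<^esub> H \<Longrightarrow> \<exists>!x. x \<in> T \<inter> C"
    using assms(8) unfolding coset_representatives_def G_def H_def Q_def by auto
  have S0: "S0 p d T \<subseteq> T" by (auto simp: S0_def Let_def)
  have t: "t \<in> carrier G" using T assms(9) by blast
  obtain c where c: "c \<in> carrier (Zmod Q)"
    and tS: "(\<lambda>j. t \<otimes>\<^bsub>Zmod Q\<^esub> j) ` SLCE_set \<alpha> = (\<lambda>j. j \<oplus>\<^bsub>Zmod Q\<^esub> c) ` SLCE_set \<alpha>"
    using assms(10) unfolding is_multiplier_def assms(7) Q_def by blast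
  have c': "0 \<le> c" "c < int Q" using c by (auto simp: R.res_carrier_eq)
  have mul: "exp_sum \<alpha> (nat t * a) = \<alpha> ^ (nat c * a) * exp_sum \<alpha> a" for a
    using exp_sum_multiplier[OF assms(6) Q(3) _ _ c'(1) tS] t by (simp add: carrier)
  have coprime_nat: "coprime (nat x) Q" if "x \<in> carrier G" for x
    using that by (metis carrier coprime_int_iff int_nat_eq less_le)
  \<comment> \<open>A unit modulo the even number \<open>Q\<close> is odd, so the sign in the
    vanishing expression is \<open>- 1\<close>.\<close>
  have half: "2 * exp_sum \<alpha> (nat (inv\<^bsub>G\<^esub> j)) = 1" if j: "j \<in> S0 p d T" for j
  proof -
    define a where "a = nat (inv\<^bsub>G\<^esub> j)"
    have inv: "inv\<^bsub>G\<^esub> j \<in> carrier G" using S0 T j by auto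
    then have a: "inv\<^bsub>G\<^esub> j = int a" "0 < a" "a < Q" "coprime a Q"
      using coprime_nat[OF inv] by (auto simp: a_def carrier)
    have "odd a"
      using a(4) \<open>even Q\<close> coprime_common_divisor[of a Q 2] by auto
    obtain i where "2 * (a * p ^ i mod Q) < Q"
      using S0_imp_small_rotation[of p d j T a] j a pd unfolding G_def Q(2) by auto
    then have "Q - a \<notin> digits_le m p d"
      using small_rotation_imp_not_digits_le[OF m, of d a i] a pd unfolding Q(2) by simp
    then have "2 * exp_sum \<alpha> a + (- 1) ^ a = 0"
      using exp_sum_vanish_iff[OF assms(1) m _ assms(6), of d a] a assms(4,5) unfolding Q(2) by simp
    then show ?thesis using \<open>odd a\<close> by (simp add: a_def)
  qed
  show ?thesis
  proof (cases "(\<lambda>j. t \<otimes>\<^bsub>G\<^esub> j) ` S0 p d T \<inter> S0 p d T = {}")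
    case False
    then obtain i where i: "i \<in> S0 p d T" "t \<otimes>\<^bsub>G\<^esub> i \<in> S0 p d T" by blast
    define j where "j = t \<otimes>\<^bsub>G\<^esub> i"
    have ij: "i \<in> carrier G" "j \<in> carrier G" using i S0 T by (auto simp: j_def)
    define a where "a = nat (inv\<^bsub>G\<^esub> j)"
    have inv_j: "inv\<^bsub>G\<^esub> j \<in> carrier G" using ij by simp
    \<comment> \<open>Thus the multiplier identity at \<open>a\<close> compares two sums that both
      equal one half, and the factor \<open>\<alpha> ^ (nat c * a)\<close> must be
      \<open>1\<close>.\<close>
    have "inv\<^bsub>G\<^esub> i = t \<otimes>\<^bsub>G\<^esub> inv\<^bsub>G\<^esub> j"
      using ij t by (simp add: j_def G.inv_mult G.m_assoc[symmetric])
    then have "nat (inv\<^bsub>G\<^esub> i) = nat t * a mod Q"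
      using t inv_j by (simp add: mult a_def carrier nat_mod_distrib nat_mult_distrib)
    then have "exp_sum \<alpha> (nat (inv\<^bsub>G\<^esub> i)) = \<alpha> ^ (nat c * a) * exp_sum \<alpha> a"
      by (simp only: exp_sum_mod[OF assms(6) Q(3)] mul)
    moreover have "2 * exp_sum \<alpha> a = 1" "2 * exp_sum \<alpha> (nat (inv\<^bsub>G\<^esub> i)) = 1"
      using half i by (auto simp: a_def j_def)
    ultimately have "\<alpha> ^ (nat c * a) = 1"
      by (metis mult.left_commute mult.right_neutral)
    then have "Q dvd nat c * a"
      by (simp only: primitive_power_eq_1_iff[OF assms(6) Q(3)])
    then have "Q dvd nat c"
      using coprime_nat[OF inv_j] by (simp add: a_def coprime_dvd_mult_left_iff coprime_commute)
    then have "nat c = 0"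
      using c' by (auto dest: dvd_imp_le)
    then have "exp_sum \<alpha> (nat t * a) = exp_sum \<alpha> a" for a
      using mul by simp
    then obtain k where k: "[nat t = p ^ k] (mod Q)"
      using multiplier_fixing_SLCE_set[OF assms(1-3) _ assms(6), of "nat t"] coprime_nat[OF t] assms(4,5)
      unfolding Q(2) by auto
    then have tk: "t = int (p ^ k) mod int Q"
    proof -
      have "nat t < Q" "t = int (nat t)" using t by (auto simp: carrier nat_less_iff)
      moreover from this have "nat t = p ^ k mod Q" using k by (simp add: cong_def)
      ultimately have "t = int (p ^ k mod Q)" by metis
      then show ?thesis by (simp only: zmod_int)
    qed
    have "coprime p Q"
      using coprime_power_diff_one[of p d] pd by (simp add: Q(2))
    then have p_G: "int p mod int Q \<in> carrier G"
      using R.mod_in_res_units[of "int p"] Q(1) by (simp add: G_def units_of_carrier)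
    \<comment> \<open>Only closure under multiplication is needed to place the nonnegative powers of
      \<open>p\<close>, and hence \<open>t\<close>, in \<open>H\<close>.\<close>
    have "int (p ^ k) mod int Q \<in> H" for k
    proof (induction k)
      case 0
      then show ?case using generate.one[of G] Q(1) by (simp add: H_def one)
    next
      case (Suc k)
      then have "(int p mod int Q) \<otimes>\<^bsub>G\<^esub> (int (p ^ k) mod int Q) \<in> H"
        unfolding H_def by (rule generate.eng[OF generate.incl[OF singletonI]])
      then show ?case by (simp add: mult mod_mult_eq)
    qed
    then have "t \<in> H" by (simp only: tk)
    have H: "subgroup H G"
      unfolding H_def by (rule G.generate_is_subgroup) (use p_G in simp)
    \<comment> \<open>Since \<open>t\<close> lies in \<open>H\<close>, both \<open>i\<close> and
      \<open>j = t * i\<close> represent this coset; uniqueness in \<open>T\<close> gives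
      \<open>j = i\<close>, and cancelling \<open>i\<close> gives \<open>t = 1\<close>.\<close>
    have coset: "H #>\<^bsub>G\<^esub> i \<in> rcosets\<^bsub>G\<^esub> H"
      using ij by (intro G.rcosetsI subgroup.subset[OF H])
    have "j \<in> H #>\<^bsub>G\<^esub> i" "i \<in> H #>\<^bsub>G\<^esub> i"
      using \<open>t \<in> H\<close> G.rcos_self[OF ij(1) H] by (auto simp: j_def r_coset_def)
    moreover have "i \<in> T" "j \<in> T" using i S0 by (auto simp: j_def)
    ultimately have "j = i" using T_unique[OF coset] by blast
    then have "t = \<one>\<^bsub>G\<^esub>" using ij t by (simp add: j_def)
    moreover have "\<one>\<^bsub>G\<^esub> \<otimes>\<^bsub>G\<^esub> x = x" if "x \<in> S0 p d T" for x
      using that S0 T by auto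
    ultimately have "(\<lambda>j. t \<otimes>\<^bsub>G\<^esub> j) ` S0 p d T = S0 p d T" by (simp add: image_def)
    then show ?thesis unfolding G_def Q_def by blast
  qed (simp add: G_def Q_def)
qed

end
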